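(* Every graph $G$ with $n\geq 3$ vertices that has no $K_{3,3}$-minor satisfies $c(G)\leq\frac{4}{3}(7n-11)$. Conversely, for every integer $n\geq 5$ with $n\equiv 2\pmod 3$ there exists a graph $G$ with $n$ vertices and no $K_{3,3}$-minor such that $c(G)=\frac{4}{3}(7n-11)$.
   Context: All graphs are finite, simple and undirected. A graph $H$ is a minor of $G$ if $H$ can be obtained from a subgraph of $G$ by contracting edges. A clique of a graph $G$ is a (possibly empty) set of pairwise adjacent vertices; $c(G)$ denotes the number of cliques of $G$ (including the empty clique, all single vertices and all edges). *)

theory Defs
  imports Complex_Main
begin

definition simple_graph :: "'a set \<Rightarrow> ('a \<Rightarrow> 'a \<Rightarrow> bool) \<Rightarrow> bool" where
  "simple_graph V E \<longleftrightarrow> finite V \<and> (\<forall>x y. E x y \<longrightarrow> x \<in> V \<and> y \<in> V)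
     \<and> (\<forall>x y. E x y \<longrightarrow> E y x) \<and> (\<forall>x. \<not> E x x)"

definition is_clique :: "'a set \<Rightarrow> ('a \<Rightarrow> 'a \<Rightarrow> bool) \<Rightarrow> 'a set \<Rightarrow> bool" where
  "is_clique V E S \<longleftrightarrow> S \<subseteq> V \<and> (\<forall>x\<in>S. \<forall>y\<in>S. x \<noteq> y \<longrightarrow> E x y)"

text \<open>c(G): number of cliques, including the empty clique.\<close>
definition num_cliques :: "'a set \<Rightarrow> ('a \<Rightarrow> 'a \<Rightarrow> bool) \<Rightarrow> nat" where
  "num_cliques V E = card {S. is_clique V E S}"

definition connected_set :: "('a \<Rightarrow> 'a \<Rightarrow> bool) \<Rightarrow> 'a set \<Rightarrow> bool" where
  "connected_set E B \<longleftrightarrow> B \<noteq> {} \<and>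
     (\<forall>u\<in>B. \<forall>v\<in>B. (\<lambda>x y. E x y \<and> x \<in> B \<and> y \<in> B)\<^sup>*\<^sup>* u v)"

text \<open>H = (W,F) is a minor of G = (V,E): there is a minor model, i.e. pairwise
  disjoint connected branch sets f w \<subseteq> V (w \<in> W) such that every edge of H
  is realised by an edge of G between the corresponding branch sets.
  (Equivalent to: H is obtained from a subgraph of G by contracting edges.)\<close>
definition is_minor :: "'b set \<Rightarrow> ('b \<Rightarrow> 'b \<Rightarrow> bool) \<Rightarrow> 'a set \<Rightarrow> ('a \<Rightarrow> 'a \<Rightarrow> bool) \<Rightarrow> bool" where
  "is_minor W F V E \<longleftrightarrow> (\<exists>f :: 'b \<Rightarrow> 'a set.
     (\<forall>w\<in>W. f w \<subseteq> V \<and> connected_set E (f w)) \<and>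
     (\<forall>w\<in>W. \<forall>w'\<in>W. w \<noteq> w' \<longrightarrow> f w \<inter> f w' = {}) \<and>
     (\<forall>w\<in>W. \<forall>w'\<in>W. F w w' \<longrightarrow> (\<exists>x\<in>f w. \<exists>y\<in>f w'. E x y)))"

definition K33_V :: "nat set" where "K33_V = {0..<6}"

definition K33_E :: "nat \<Rightarrow> nat \<Rightarrow> bool" where
  "K33_E i j \<longleftrightarrow> (i < 3 \<and> 3 \<le> j \<and> j < 6) \<or> (j < 3 \<and> 3 \<le> i \<and> i < 6)"

definition K33_minor_free :: "'a set \<Rightarrow> ('a \<Rightarrow> 'a \<Rightarrow> bool) \<Rightarrow> bool" where
  "K33_minor_free V E \<longleftrightarrow> \<not> is_minor K33_V K33_E V E"

end

theory Submission
  imports Defs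
begin

text \<open>
  The upper bound is proved by induction on the number of vertices. Contracting an edge with at
  most two common neighbours loses at most eight cliques, which is below the allowance of 28/3
  per vertex. If every edge lies in at least three triangles, then a vertex of degree at most 5
  that is not isolated has degree 4 and its closed neighbourhood is a $K_5$: five neighbours
  would already give a $K_{3,3}$ in the closed neighbourhood. A component of the rest of the
  graph with three neighbours in this $K_5$ would also give a $K_{3,3}$-minor, so the graph splits
  along an edge, and the bound is exactly compatible with such splittings. A vertex of degree at
  most 5 exists because a $K_{3,3}$-minor-free graph has at most 3n - 5 edges, and this follows
  by the same induction. This avoids planarity and Wagner's structure theorem.

  In the extremal graphs all copies of $K_5$ share one edge. At most two branch sets of a
  $K_{3,3}$-model meet that edge, and the others, still adjacent in a connected pattern, would be
  at least four disjoint sets inside one triple of vertices.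
\<close>

section \<open>Minors\<close>

abbreviation induced :: "('a \<Rightarrow> 'a \<Rightarrow> bool) \<Rightarrow> 'a set \<Rightarrow> 'a \<Rightarrow> 'a \<Rightarrow> bool" where
  "induced E A \<equiv> \<lambda>x y. E x y \<and> x \<in> A \<and> y \<in> A"

text \<open>The merged vertex keeps the name \<open>v\<close>, so the vertex set becomes
  \<open>V - {w}\<close> inside the same type. The condition \<open>x \<noteq> y\<close> discards
  the loop that the edge between \<open>v\<close> and \<open>w\<close> would leave.\<close>

definition contract :: "('a \<Rightarrow> 'a \<Rightarrow> bool) \<Rightarrow> 'a \<Rightarrow> 'a \<Rightarrow> 'a \<Rightarrow> 'a \<Rightarrow> bool" where
  "contract E v w x y \<longleftrightarrow> x \<noteq> w \<and> y \<noteq> w \<and> x \<noteq> y \<and>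
     (E x y \<or> x = v \<and> E w y \<or> y = v \<and> E x w)"

definition common_nbrs :: "('a \<Rightarrow> 'a \<Rightarrow> bool) \<Rightarrow> 'a \<Rightarrow> 'a \<Rightarrow> 'a set" where
  "common_nbrs E v w = {u. E v u \<and> E w u}"

lemma simple_graph_induced:
  assumes "simple_graph V E" "A \<subseteq> V"
  shows "simple_graph A (induced E A)"
  using assms finite_subset unfolding simple_graph_def by auto

lemma simple_graph_contract:
  assumes "simple_graph V E" "E v w"
  shows "simple_graph (V - {w}) (contract E v w)"
  using assms unfolding simple_graph_def contract_def by auto

lemma connected_set_singleton: "connected_set E {x}"
  unfolding connected_set_def by auto

lemma connected_set_mono:
  assumes "connected_set E B" and "\<And>x y. E x y \<Longrightarrow> E' x y"
  shows "connected_set E' B"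
proof -
  have "(induced E B)\<^sup>*\<^sup>* u v \<Longrightarrow> (induced E' B)\<^sup>*\<^sup>* u v" for u v
    by (erule rtranclp_mono[THEN predicate2D, rotated]) (auto intro: assms(2))
  then show ?thesis using assms(1) unfolding connected_set_def by blast
qed

lemma K33_minor_free_subgraph:
  assumes "K33_minor_free V E" "V' \<subseteq> V" "\<And>x y. E' x y \<Longrightarrow> E x y"
  shows "K33_minor_free V' E'"
  unfolding K33_minor_free_def
proof
  assume "is_minor K33_V K33_E V' E'"
  then have "is_minor K33_V K33_E V E"
    unfolding is_minor_def
    by (elim ex_forward conj_forward) (use assms(2,3) connected_set_mono[of E' _ E] in blast)+
  then show False using assms(1) unfolding K33_minor_free_def by simp
qed

text \<open>A step of the contraction that is no edge of \<open>E\<close> has \<open>v\<close> as an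
  end and becomes a detour of two edges through \<open>w\<close>; the vertex \<open>w\<close> itself
  hangs on \<open>v\<close>.\<close>

lemma connected_set_uncontract:
  assumes G: "simple_graph V E" "E v w" and B: "connected_set (contract E v w) B" "w \<notin> B"
  shows "connected_set E (if v \<in> B then insert w B else B)"
proof -
  define B' where "B' = (if v \<in> B then insert w B else B)"
  have sym: "E x y \<Longrightarrow> E y x" for x y using G unfolding simple_graph_def by blast
  have step: "(induced E B')\<^sup>*\<^sup>* x y" if "induced (contract E v w) B x y" for x y
  proof (cases "E x y")
    case True
    then show ?thesis using that by (auto simp: B'_def)
  next
    case False
    then have "x = v \<and> E w y \<or> y = v \<and> E x w" using that by (auto simp: contract_def)
    then have "induced E B' x w \<and> induced E B' w y"
      using that G(2) sym[OF G(2)] by (auto simp: B'_def)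
    then show ?thesis
      by (intro rtranclp.rtrancl_into_rtrancl[of _ x w y] r_into_rtranclp) auto
  qed
  have path: "(induced E B')\<^sup>*\<^sup>* x y" if "x \<in> B" "y \<in> B" for x y
  proof -
    have "(induced (contract E v w) B)\<^sup>*\<^sup>* x y"
      using B(1) that unfolding connected_set_def by blast
    then show ?thesis
      by induction (auto intro: rtranclp_trans step)
  qed
  have "(induced E B')\<^sup>*\<^sup>* x y" if "x \<in> B'" "y \<in> B'" for x y
  proof -
    have ex: "\<exists>z\<in>B. (induced E B')\<^sup>*\<^sup>* x z \<and> (induced E B')\<^sup>*\<^sup>* z x" if x: "x \<in> B'" for x
    proof (cases "x \<in> B")
      case False
      then have "x = w" "v \<in> B" using x by (auto simp: B'_def split: if_splits)
      then have "induced E B' x v" "induced E B' v x"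
        using G(2) sym[OF G(2)] by (auto simp: B'_def)
      then show ?thesis using \<open>v \<in> B\<close> by blast
    qed auto
    show ?thesis using ex[OF that(1)] ex[OF that(2)] path by (meson rtranclp_trans)
  qed
  moreover have "B' \<noteq> {}" using B(1) by (auto simp: B'_def connected_set_def)
  ultimately show ?thesis unfolding connected_set_def B'_def[symmetric] by blast
qed

text \<open>A model in the contraction lifts when \<open>w\<close> joins the branch set containing
  \<open>v\<close>, if there is one. A new edge of the contraction is then realised by an edge at
  \<open>w\<close>.\<close>

lemma K33_minor_free_contract:
  assumes G: "simple_graph V E" "E v w" and free: "K33_minor_free V E"
  shows "K33_minor_free (V - {w}) (contract E v w)"
  unfolding K33_minor_free_def
proof
  assume "is_minor K33_V K33_E (V - {w}) (contract E v w)"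
  then obtain f where
    con: "\<forall>i\<in>K33_V. f i \<subseteq> V - {w} \<and> connected_set (contract E v w) (f i)" and
    dis: "\<forall>i\<in>K33_V. \<forall>j\<in>K33_V. i \<noteq> j \<longrightarrow> f i \<inter> f j = {}" and
    adj: "\<forall>i\<in>K33_V. \<forall>j\<in>K33_V. K33_E i j \<longrightarrow> (\<exists>x\<in>f i. \<exists>y\<in>f j. contract E v w x y)"
    unfolding is_minor_def by (elim exE conjE) (rule that)
  have w: "w \<in> V" using G unfolding simple_graph_def by blast
  have sym: "E x y \<Longrightarrow> E y x" for x y using G unfolding simple_graph_def by blast
  define g where "g i = (if v \<in> f i then insert w (f i) else f i)" for i
  have "g i \<subseteq> V \<and> connected_set E (g i)" if "i \<in> K33_V" for i
  proof -
    have "w \<notin> f i" "f i \<subseteq> V" "connected_set (contract E v w) (f i)" using con that by blast+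
    then show ?thesis using w connected_set_uncontract[OF G] by (simp add: g_def)
  qed
  moreover have "g i \<inter> g j = {}" if "i \<in> K33_V" "j \<in> K33_V" "i \<noteq> j" for i j
    using con[rule_format, OF that(1)] con[rule_format, OF that(2)] dis[rule_format, OF that]
    by (auto simp: g_def)
  moreover have "\<exists>x\<in>g i. \<exists>y\<in>g j. E x y" if "i \<in> K33_V" "j \<in> K33_V" "K33_E i j" for i j
  proof -
    obtain x y where xy: "x \<in> f i" "y \<in> f j" "contract E v w x y"
      using adj \<open>i \<in> K33_V\<close> \<open>j \<in> K33_V\<close> \<open>K33_E i j\<close> by blast
    then consider "E x y" | "x = v" "E w y" | "y = v" "E x w" by (auto simp: contract_def)
    then show ?thesis using xy by cases (auto simp: g_def)
  qed
  ultimately have "is_minor K33_V K33_E V E"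
    unfolding is_minor_def by (intro exI[of _ g] conjI ballI impI) simp_all
  then show False using free unfolding K33_minor_free_def by simp
qed

text \<open>The only shape of model needed for the upper bound: \<open>a\<close>, \<open>b\<close>,
  \<open>c\<close> against \<open>d\<close>, \<open>e\<close>, \<open>C\<close>, where all branch
  sets except \<open>C\<close> are single vertices.\<close>

lemma not_K33_minor_freeI:
  assumes G: "simple_graph V E"
    and dist: "distinct [a, b, c, d, e]"
    and adj: "\<And>x y. x \<in> {a, b, c} \<Longrightarrow> y \<in> {d, e} \<Longrightarrow> E x y"
    and C: "C \<subseteq> V" "connected_set E C" "C \<inter> {a, b, c, d, e} = {}"
    and att: "\<And>x. x \<in> {a, b, c} \<Longrightarrow> \<exists>y\<in>C. E x y"
  shows "\<not> K33_minor_free V E"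
proof -
  have sym: "E x y \<Longrightarrow> E y x" for x y using G unfolding simple_graph_def by blast
  have inV: "{a, b, c, d, e} \<subseteq> V"
    using adj[of a d] adj[of b d] adj[of c d] adj[of a e] G unfolding simple_graph_def by simp
  define f where "f i = [{a}, {b}, {c}, {d}, {e}, C] ! i" for i
  have K: "i \<in> K33_V \<longleftrightarrow> i = 0 \<or> i = 1 \<or> i = 2 \<or> i = 3 \<or> i = 4 \<or> i = 5" for i
    unfolding K33_V_def by auto
  have f: "f 0 = {a}" "f (Suc 0) = {b}" "f 2 = {c}" "f 3 = {d}" "f 4 = {e}" "f 5 = C"
    by (simp_all add: f_def numeral_eq_Suc)
  have edge: "\<exists>x\<in>f i. \<exists>y\<in>f j. E x y" if "i \<in> {0, 1, 2}" "j \<in> {3, 4, 5}" for i j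
    using that adj att by (auto simp: f)
  have "f i \<subseteq> V \<and> connected_set E (f i)" if "i \<in> K33_V" for i
    using that inV C by (auto simp: K f connected_set_singleton)
  moreover have "f i \<inter> f j = {}" if "i \<in> K33_V" "j \<in> K33_V" "i \<noteq> j" for i j
    using that dist C(3) unfolding K by (elim disjE; simp add: f)
  moreover have "\<exists>x\<in>f i. \<exists>y\<in>f j. E x y" if "i \<in> K33_V" "j \<in> K33_V" "K33_E i j" for i j
  proof -
    from that have "i \<in> {0, 1, 2} \<and> j \<in> {3, 4, 5} \<or> j \<in> {0, 1, 2} \<and> i \<in> {3, 4, 5}"
      unfolding K33_E_def by auto
    then show ?thesis using edge[of i j] edge[of j i] sym by blast
  qed
  ultimately have "is_minor K33_V K33_E V E"
    unfolding is_minor_def by (intro exI[of _ f] conjI ballI impI) simp_all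
  then show ?thesis unfolding K33_minor_free_def by simp
qed

section \<open>Graphs with a vertex of small degree\<close>

lemma K5_closed_neighbourhood:
  assumes G: "simple_graph V E" and free: "K33_minor_free V E"
    and tri: "\<And>x y. E x y \<Longrightarrow> 3 \<le> card (common_nbrs E x y)"
    and N: "{u. E v u} \<noteq> {}" "card {u. E v u} \<le> 5"
  shows "is_clique V E (insert v {u. E v u})" "card (insert v {u. E v u}) = 5"
proof -
  define N where "N = {u. E v u}"
  have sym: "E x y \<Longrightarrow> E y x" and irr: "\<not> E x x" and inV: "E x y \<Longrightarrow> x \<in> V \<and> y \<in> V" for x y
    using G unfolding simple_graph_def by blast+
  have NV: "N \<subseteq> V" using inV by (auto simp: N_def)
  then have fin: "finite N" using G finite_subset unfolding simple_graph_def by blast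
  have vN: "v \<notin> N" using irr by (simp add: N_def)
  \<comment> \<open>The vertex \<open>x\<close> and at least three common neighbours of
    \<open>v\<close> and \<open>x\<close> all lie in \<open>N\<close>; this is the 4.\<close>
  have non: "card {y \<in> N. y \<noteq> x \<and> \<not> E x y} + 4 \<le> card N" if "x \<in> N" for x
  proof -
    define M where "M = {y \<in> N. y \<noteq> x \<and> \<not> E x y}"
    have N: "N = insert x (common_nbrs E v x \<union> M)"
      using that by (auto simp: N_def M_def common_nbrs_def)
    then have "finite (common_nbrs E v x)" "finite M" using fin by (metis finite_Un finite_insert)+
    moreover have "x \<notin> common_nbrs E v x \<union> M" "common_nbrs E v x \<inter> M = {}"
      using irr by (auto simp: M_def common_nbrs_def)
    ultimately have "card N = Suc (card (common_nbrs E v x) + card M)"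
      by (subst N) (simp add: card_Un_disjoint)
    moreover have "3 \<le> card (common_nbrs E v x)" using tri that by (simp add: N_def)
    ultimately show ?thesis unfolding M_def by simp
  qed
  obtain x where "x \<in> N" using N(1) by (auto simp: N_def)
  then have ge4: "4 \<le> card N" using non[of x] by simp
  have ne5: "card N \<noteq> 5"
  proof
    assume c5: "card N = 5"
    \<comment> \<open>With five neighbours, the missing edges inside \<open>N\<close> form a
      matching.\<close>
    have uniq: "y = z" if "x \<in> N" "y \<in> N" "z \<in> N" "y \<noteq> x" "z \<noteq> x" "\<not> E x y" "\<not> E x z" for x y z
    proof -
      have "card {y \<in> N. y \<noteq> x \<and> \<not> E x y} \<le> Suc 0" using non[OF that(1)] c5 by simp
      then show ?thesis using that fin by (subst (asm) card_le_Suc0_iff_eq) auto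
    qed
    \<comment> \<open>If an edge is missing in \<open>N\<close>, its ends are chosen: by the
      matching property they are adjacent to the other three vertices. These three then face
      \<open>d\<close>, \<open>e\<close> and \<open>v\<close>.\<close>
    obtain d e where de: "d \<in> N" "e \<in> N" "d \<noteq> e"
      "\<And>x. x \<in> N - {d, e} \<Longrightarrow> E x d \<and> E x e"
    proof (cases "\<exists>d\<in>N. \<exists>e\<in>N. d \<noteq> e \<and> \<not> E d e")
      case True
      then obtain d e where de: "d \<in> N" "e \<in> N" "d \<noteq> e" "\<not> E d e" by blast
      then have "E x d \<and> E x e" if "x \<in> N - {d, e}" for x
        using that uniq[of d e x] uniq[of e d x] sym by blast
      with de that show ?thesis by blast
    next
      case False
      obtain d e where "d \<in> N" "e \<in> N" "d \<noteq> e"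
        using c5 card_le_Suc0_iff_eq[OF fin] by fastforce
      with False that show ?thesis by blast
    qed
    have "card (N - {d, e}) = 3" using de c5 fin by (simp add: card_Diff_subset)
    then obtain a b c where abc: "N - {d, e} = {a, b, c}" "a \<noteq> b" "b \<noteq> c" "a \<noteq> c"
      by (auto simp: card_3_iff)
    have mem: "a \<in> N - {d, e}" "b \<in> N - {d, e}" "c \<in> N - {d, e}" unfolding abc by auto
    have "\<not> K33_minor_free V E"
    proof (rule not_K33_minor_freeI[OF G, of a b c d e "{v}"])
      show "{v} \<subseteq> V" using N(1) inV by blast
      show "E x y" if "x \<in> {a, b, c}" "y \<in> {d, e}" for x y
        using that de(4)[of x] unfolding abc(1) by auto
      show "\<exists>y\<in>{v}. E x y" if "x \<in> {a, b, c}" for x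
        using that mem sym by (auto simp: N_def)
    qed (use abc mem de vN in \<open>auto simp: connected_set_singleton\<close>)
    then show False using free by simp
  qed
  have c4: "card N = 4" using ge4 ne5 N(2) by (simp add: N_def)
  have "E x y" if "x \<in> N" "y \<in> N" "y \<noteq> x" for x y
  proof -
    have "card {y \<in> N. y \<noteq> x \<and> \<not> E x y} = 0" using non[OF that(1)] c4 by simp
    then show ?thesis using fin that by auto
  qed
  then show "is_clique V E (insert v {u. E v u})"
    using sym NV N(1) inV unfolding is_clique_def N_def by blast
  show "card (insert v {u. E v u}) = 5"
    using c4 vN fin by (simp add: N_def)
qed

text \<open>A separation of order two whose separator is already an edge. Both sides are therefore
  plain induced subgraphs, and no edge has to be added that might create a minor. Properness makes
  both sides smaller than \<open>V\<close>.\<close>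

definition edge_split :: "'a set \<Rightarrow> ('a \<Rightarrow> 'a \<Rightarrow> bool) \<Rightarrow> 'a set \<Rightarrow> 'a set \<Rightarrow> 'a \<Rightarrow> 'a \<Rightarrow> bool" where
  "edge_split V E A B u w \<longleftrightarrow> A \<union> B = V \<and> A \<inter> B = {u, w} \<and> A \<subset> V \<and> B \<subset> V \<and> E u w \<and>
     (\<forall>x y. E x y \<longrightarrow> x \<in> A \<and> y \<in> A \<or> x \<in> B \<and> y \<in> B)"

text \<open>A component outside \<open>Q\<close> with three attachments in \<open>Q\<close> could be
  the sixth branch set, those three vertices facing it and the other two vertices of
  \<open>Q\<close>. With at most two attachments it can be cut off along an edge of
  \<open>Q\<close>.\<close>

lemma K5_edge_split:
  assumes G: "simple_graph V E" and free: "K33_minor_free V E"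
    and Q: "is_clique V E Q" "card Q = 5" "Q \<noteq> V"
  obtains A B u w where "edge_split V E A B u w"
proof -
  have sym: "E x y \<Longrightarrow> E y x" and irr: "\<not> E x x" and inV: "E x y \<Longrightarrow> x \<in> V \<and> y \<in> V" for x y
    using G unfolding simple_graph_def by blast+
  have QV: "Q \<subseteq> V" and QE: "\<And>x y. x \<in> Q \<Longrightarrow> y \<in> Q \<Longrightarrow> x \<noteq> y \<Longrightarrow> E x y"
    using Q(1) unfolding is_clique_def by blast+
  have finQ: "finite Q" using Q(2) card.infinite by force
  obtain x0 where x0: "x0 \<in> V - Q" using Q(3) QV by blast
  define R where "R = induced E (V - Q)"
  \<comment> \<open>The component of \<open>x0\<close> in the graph without
    \<open>Q\<close>.\<close>
  define C where "C = {y. R\<^sup>*\<^sup>* x0 y}"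
  have CV: "C \<subseteq> V - Q"
  proof
    fix y assume "y \<in> C"
    then have "R\<^sup>*\<^sup>* x0 y" by (simp add: C_def)
    then show "y \<in> V - Q" by induction (use x0 in \<open>auto simp: R_def\<close>)
  qed
  have x0C: "x0 \<in> C" by (simp add: C_def)
  have closed: "y \<in> C" if "x \<in> C" "E x y" "y \<notin> Q" for x y
  proof -
    have "R x y" using that CV inV by (auto simp: R_def)
    then show ?thesis using that(1) by (auto simp: C_def intro: rtranclp.rtrancl_into_rtrancl)
  qed
  have conC: "connected_set E C"
  proof -
    have from_x0: "(induced E C)\<^sup>*\<^sup>* x0 y" if "y \<in> C" for y
    proof -
      have "R\<^sup>*\<^sup>* x0 y" using that by (simp add: C_def)
      then show ?thesis
      proof induction
        case (step y z)
        then have "induced E C y z"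
          by (auto simp: C_def R_def intro: rtranclp.rtrancl_into_rtrancl)
        with step.IH show ?case by (rule rtranclp.rtrancl_into_rtrancl)
      qed simp
    qed
    have "symp (induced E C)" using sym by (auto intro: sympI)
    then have "symp ((induced E C)\<^sup>*\<^sup>*)" by (rule symp_rtranclp)
    then have "(induced E C)\<^sup>*\<^sup>* y z" if "y \<in> C" "z \<in> C" for y z
      using from_x0[OF that(1)] from_x0[OF that(2)] by (meson rtranclp_trans sympD)
    then show ?thesis using x0C unfolding connected_set_def by blast
  qed
  define S where "S = {q \<in> Q. \<exists>y\<in>C. E q y}"
  have "card S \<le> 2"
  proof (rule ccontr)
    assume "\<not> card S \<le> 2"
    then obtain T where T: "T \<subseteq> S" "card T = 3"
      by (metis not_less_eq_eq numeral_2_eq_2 numeral_3_eq_3 obtain_subset_with_card_n)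
    then obtain a b c where abc: "T = {a, b, c}" "a \<noteq> b" "b \<noteq> c" "a \<noteq> c"
      by (auto simp: card_3_iff)
    have TQ: "T \<subseteq> Q" using T by (auto simp: S_def)
    then have "card (Q - T) = 2" using T Q(2) finQ finite_subset by (subst card_Diff_subset) auto
    then obtain d e where de: "Q - T = {d, e}" "d \<noteq> e" by (auto simp: card_2_iff)
    have mem: "d \<in> Q - T" "e \<in> Q - T" unfolding de by auto
    have "\<not> K33_minor_free V E"
    proof (rule not_K33_minor_freeI[OF G, of a b c d e C])
      show "E x y" if "x \<in> {a, b, c}" "y \<in> {d, e}" for x y
        using that mem TQ by (intro QE) (auto simp: abc)
      show "\<exists>y\<in>C. E x y" if "x \<in> {a, b, c}" for x
        using that T by (auto simp: abc S_def)
      show "C \<inter> {a, b, c, d, e} = {}" using CV mem TQ by (auto simp: abc)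
    qed (use abc mem de CV conC in auto)
    then show False using free by simp
  qed
  moreover have "S \<subseteq> Q" by (auto simp: S_def)
  ultimately obtain U where U: "S \<subseteq> U" "U \<subseteq> Q" "card U = 2"
    using exists_subset_between[of S 2 Q] Q(2) finQ by auto
  then obtain u w where uw: "U = {u, w}" "u \<noteq> w" by (auto simp: card_2_iff)
  have "card (Q - U) = 3" using U Q(2) finQ finite_subset by (subst card_Diff_subset) auto
  \<comment> \<open>The vertex \<open>q\<close> shows that \<open>C \<union> U\<close> is a proper
    part; \<open>x0\<close> does the same for \<open>V - C\<close>.\<close>
  then obtain q where q: "q \<in> Q - U" by (metis card.empty ex_in_conv zero_neq_numeral)
  have "x \<in> V - C \<and> y \<in> V - C \<or> x \<in> C \<union> U \<and> y \<in> C \<union> U" if "E x y" for x y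
    using that inV[OF that] sym[OF that] closed[of x y] closed[of y x] U(1)
    by (auto simp: S_def)
  then have "edge_split V E (V - C) (C \<union> U) u w"
    unfolding edge_split_def
  proof (intro conjI)
    show "E u w" using U uw QE by blast
  qed (use U uw q x0C CV QV in blast)+
  then show ?thesis by (rule that)
qed

text \<open>The case distinction shared by the inductions for edges and for cliques. In case
  \<open>K5\<close> the order alone suffices: on five vertices even the complete graph satisfies
  both bounds, with equality.\<close>

lemma small_degree_cases:
  assumes G: "simple_graph V E" and free: "K33_minor_free V E"
    and v: "v \<in> V" "card {u. E v u} \<le> 5"
  obtains (isolated) "{u. E v u} = {}"
  | (contract) x y where "E x y" "card (common_nbrs E x y) \<le> 2"
  | (K5) "card V = 5"
  | (split) A B u w where "edge_split V E A B u w"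
proof (cases "{u. E v u} = {} \<or> (\<exists>x y. E x y \<and> card (common_nbrs E x y) \<le> 2)")
  case True
  then show ?thesis using isolated contract by blast
next
  case False
  then have "3 \<le> card (common_nbrs E x y)" if "E x y" for x y
    using that by (metis not_less_eq_eq numeral_2_eq_2 numeral_3_eq_3)
  note Q = K5_closed_neighbourhood[OF G free this _ v(2)]
  show ?thesis
  proof (cases "insert v {u. E v u} = V")
    case True
    then show ?thesis using Q(2) False K5 by metis
  next
    case neq: False
    then show ?thesis using K5_edge_split[OF G free Q neq] False split by metis
  qed
qed

text \<open>Each side has at least three vertices since the other side misses a vertex; this keeps
  both sides in the range of the induction hypotheses.\<close>

lemma edge_split_card:
  assumes G: "simple_graph V E" and s: "edge_split V E A B u w"
  shows "card A + card B = card V + 2" "card A < card V" "card B < card V"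
    "3 \<le> card A" "3 \<le> card B"
proof -
  have fin: "finite V" and "u \<noteq> w" using G s unfolding simple_graph_def edge_split_def by auto
  moreover have fAB: "finite A" "finite B"
    using s fin finite_subset unfolding edge_split_def by blast+
  ultimately show sum: "card A + card B = card V + 2"
    using card_Un_Int[of A B] s unfolding edge_split_def by simp
  have "A \<subset> V" "B \<subset> V" using s unfolding edge_split_def by simp_all
  then show "card A < card V" "card B < card V" by (simp_all add: psubset_card_mono[OF fin])
  with sum show "3 \<le> card A" "3 \<le> card B" by linarith+
qed

section \<open>The edge bound\<close>

definition arcs :: "('a \<Rightarrow> 'a \<Rightarrow> bool) \<Rightarrow> ('a \<times> 'a) set" where
  "arcs E = {(x, y). E x y}"

lemma finite_arcs: "simple_graph V E \<Longrightarrow> finite (arcs E)"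
  by (rule finite_subset[of _ "V \<times> V"]) (auto simp: arcs_def simple_graph_def)

lemma card_arcs:
  assumes "simple_graph V E"
  shows "card (arcs E) = (\<Sum>v\<in>V. card {u. E v u})"
proof -
  have "arcs E = Sigma V (\<lambda>v. {u. E v u})"
    using assms by (auto simp: arcs_def simple_graph_def)
  moreover have "finite {u. E v u}" for v
    using assms by (auto simp: simple_graph_def intro: rev_finite_subset[of V])
  ultimately show ?thesis using assms by (simp add: simple_graph_def)
qed

text \<open>What is lost is the edge itself and one of the two edges to each common neighbour; the
  factor 2 is for both directions.\<close>

lemma card_arcs_contract:
  assumes G: "simple_graph V E" and vw: "E v w"
  shows "card (arcs E) \<le> card (arcs (contract E v w)) + 2 * (1 + card (common_nbrs E v w))"
proof -
  have sym: "E x y \<Longrightarrow> E y x" and irr: "\<not> E x x" and inV: "E x y \<Longrightarrow> x \<in> V \<and> y \<in> V" for x y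
    using G unfolding simple_graph_def by blast+
  have fin: "finite X" if "X \<subseteq> V" for X
    using that G finite_subset unfolding simple_graph_def by blast
  \<comment> \<open>The vertices of \<open>Z\<close> become new neighbours of \<open>v\<close> and
    make up for their lost edges to \<open>w\<close>; the arcs in \<open>D\<close> survive
    unchanged.\<close>
  define Z where "Z = {u. E w u \<and> \<not> E v u \<and> u \<noteq> v}"
  define D where "D = {(x, y). E x y \<and> x \<noteq> w \<and> y \<noteq> w}"
  have finZ: "finite Z" and finC: "finite (common_nbrs E v w)"
    using inV by (auto intro!: fin simp: Z_def common_nbrs_def)
  have finD: "finite D"
    by (rule finite_subset[OF _ finite_arcs[OF G]]) (auto simp: D_def arcs_def)
  have N: "{u. E w u} = insert v (common_nbrs E v w \<union> Z)"
    using sym[OF vw] by (auto simp: Z_def common_nbrs_def)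
  have cN: "card {u. E w u} \<le> Suc (card (common_nbrs E v w) + card Z)"
    unfolding N using finZ finC card_Un_le[of "common_nbrs E v w" Z]
    by (simp add: card_insert_if)
  have "arcs E \<subseteq> D \<union> (Pair w ` {u. E w u} \<union> (\<lambda>u. (u, w)) ` {u. E w u})"
    using sym by (auto simp: arcs_def D_def)
  then have "card (arcs E) \<le> card (D \<union> (Pair w ` {u. E w u} \<union> (\<lambda>u. (u, w)) ` {u. E w u}))"
    using finD inV by (intro card_mono) (auto intro!: fin)
  also have "\<dots> \<le> card D + (card (Pair w ` {u. E w u}) + card ((\<lambda>u. (u, w)) ` {u. E w u}))"
    by (meson card_Un_le add_left_mono order_trans)
  also have "\<dots> \<le> card D + 2 * card {u. E w u}"
    using card_image_le[OF fin[of "{u. E w u}"], of "Pair w"]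
      card_image_le[OF fin[of "{u. E w u}"], of "\<lambda>u. (u, w)"] inV by force
  also have "\<dots> \<le> (card D + 2 * card Z) + 2 * (1 + card (common_nbrs E v w))"
    using cN by simp
  also have "card D + 2 * card Z = card (D \<union> (Pair v ` Z \<union> (\<lambda>u. (u, v)) ` Z))"
  proof -
    have "card (Pair v ` Z \<union> (\<lambda>u. (u, v)) ` Z) = card Z + card Z"
      using finZ by (subst card_Un_disjoint) (auto simp: card_image inj_on_def Z_def)
    moreover have "D \<inter> (Pair v ` Z \<union> (\<lambda>u. (u, v)) ` Z) = {}"
      using sym by (auto simp: D_def Z_def)
    ultimately show ?thesis using finZ finD by (subst card_Un_disjoint) auto
  qed
  also have "\<dots> \<le> card (arcs (contract E v w))"
    using finite_arcs[OF simple_graph_contract[OF G vw]] irr vw sym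
    by (intro card_mono) (auto simp: D_def Z_def arcs_def contract_def)
  finally show ?thesis by simp
qed

text \<open>Only the two arcs between \<open>u\<close> and \<open>w\<close> are counted on both
  sides.\<close>

lemma card_arcs_split:
  assumes G: "simple_graph V E" and s: "edge_split V E A B u w"
  shows "card (arcs E) + 2 = card (arcs (induced E A)) + card (arcs (induced E B))"
proof -
  have fin: "finite (arcs (induced E X))" for X
    by (rule finite_subset[OF _ finite_arcs[OF G]]) (auto simp: arcs_def)
  have I: "A \<inter> B = {u, w}" and uw: "E u w"
    and adj: "\<And>x y. E x y \<Longrightarrow> x \<in> A \<and> y \<in> A \<or> x \<in> B \<and> y \<in> B"
    using s unfolding edge_split_def by blast+
  have wu: "E w u" and irr: "\<not> E x x" for x using G uw unfolding simple_graph_def by blast+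
  have "arcs E = arcs (induced E A) \<union> arcs (induced E B)"
    using adj unfolding arcs_def by blast
  moreover have "arcs (induced E A) \<inter> arcs (induced E B) =
      {(x, y). E x y \<and> x \<in> A \<inter> B \<and> y \<in> A \<inter> B}"
    unfolding arcs_def by blast
  then have "arcs (induced E A) \<inter> arcs (induced E B) = {(u, w), (w, u)}"
    unfolding I using uw wu irr by blast
  moreover have "u \<noteq> w" using uw irr by blast
  ultimately show ?thesis using card_Un_Int[OF fin fin, of A B] by simp
qed

text \<open>Arcs count every edge twice, so this is the bound of 3n - 5 edges.\<close>
lemma card_arcs_le:
  assumes "simple_graph V E" "K33_minor_free V E" "2 \<le> card V"
  shows "card (arcs E) + 10 \<le> 6 * card V"
  using assms
\<comment> \<open>The order is lexicographic, vertices before arcs, because the hypothesis is also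
  applied after deleting an edge on the same vertex set.\<close>
proof (induction "(V, E)" arbitrary: V E
    rule: wf_induct_rule[OF wf_measures[of "[card \<circ> fst, card \<circ> arcs \<circ> snd]"]])
  case less: 1
  note G = less.prems(1) and free = less.prems(2)
  have sym: "E x y \<Longrightarrow> E y x" and irr: "\<not> E x x" and inV: "E x y \<Longrightarrow> x \<in> V \<and> y \<in> V" for x y
    using G unfolding simple_graph_def by blast+
  have finV: "finite V" using G unfolding simple_graph_def by blast
  show ?case
  proof (cases "arcs E = {}")
    case True
    then show ?thesis using less.prems(3) by simp
  next
    case False
    then obtain a b where ab: "E a b" by (auto simp: arcs_def)
    \<comment> \<open>By induction deleting one edge brings the graph within the bound, so the average
      degree is below 6.\<close>
    define E' where "E' x y \<longleftrightarrow> E x y \<and> {x, y} \<noteq> {a, b}" for x y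
    have G': "simple_graph V E'" using G unfolding simple_graph_def E'_def by (auto simp: insert_commute)
    have arcs: "arcs E = arcs E' \<union> {(a, b), (b, a)}" "arcs E' \<inter> {(a, b), (b, a)} = {}"
      using ab sym by (auto simp: arcs_def E'_def doubleton_eq_iff)
    have "a \<noteq> b" using ab irr by auto
    then have cE: "card (arcs E) = card (arcs E') + 2"
      unfolding arcs(1) using arcs(2) finite_arcs[OF G'] by (subst card_Un_disjoint) auto
    have "card (arcs E') + 10 \<le> 6 * card V"
      using cE less.prems(3) by (intro less.hyps[OF _ G' K33_minor_free_subgraph[OF free]])
        (auto simp: E'_def)
    then have "(\<Sum>v\<in>V. card {u. E v u}) < (\<Sum>v\<in>V. 6)"
      using cE card_arcs[OF G] by simp
    then obtain v where v: "v \<in> V" "card {u. E v u} < 6"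
      by (meson not_less sum_mono)
    have v5: "card {u. E v u} \<le> 5" using v by simp
    show ?thesis
    proof (cases "card V = 2")
      case True
      \<comment> \<open>Two vertices carry at most two arcs, and 2 + 10 = 6 * 2.\<close>
      have "arcs E \<subseteq> V \<times> V - (\<lambda>x. (x, x)) ` V" using inV irr by (auto simp: arcs_def)
      then have "card (arcs E) \<le> card (V \<times> V - (\<lambda>x. (x, x)) ` V)"
        using finV by (intro card_mono) auto
      also have "\<dots> = 2"
        using finV True by (subst card_Diff_subset) (auto simp: card_image inj_on_def card_cartesian_product)
      finally show ?thesis using True by simp
    next
      case False
      then have n3: "3 \<le> card V" using less.prems(3) by simp
      from G free v(1) v5 show ?thesis
      proof (cases rule: small_degree_cases)
        case isolated
        have eq: "arcs (induced E (V - {v})) = arcs E"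
          using isolated sym inV by (auto simp: arcs_def)
        have "card (arcs (induced E (V - {v}))) + 10 \<le> 6 * card (V - {v})"
          using G free v(1) finV n3 less.prems(3) unfolding eq[symmetric]
          by (intro less.hyps simple_graph_induced[OF G] K33_minor_free_subgraph[OF free])
            (auto simp: eq card_gt_0_iff)
        then show ?thesis using v(1) finV unfolding eq by simp
      next
        case (contract x y)
        \<comment> \<open>At most 2 * (1 + 2) = 6 arcs are lost, exactly the allowance for one
          vertex.\<close>
        note C = card_arcs_contract[OF G contract(1)]
        have y: "card (V - {y}) = card V - 1" using inV[OF contract(1)] finV by simp
        have "card (arcs (contract E x y)) + 10 \<le> 6 * card (V - {y})"
          using y n3 by (intro less.hyps simple_graph_contract[OF G]
              K33_minor_free_contract[OF G _ free] contract(1)) auto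
        then show ?thesis using C y n3 contract(2) by simp
      next
        case K5
        have "card {u. E v u} \<le> 4" if "v \<in> V" for v
        proof -
          have "card {u. E v u} \<le> card (V - {v})"
            using inV irr finV by (intro card_mono) auto
          then show ?thesis using K5 that finV by simp
        qed
        then have "card (arcs E) \<le> (\<Sum>v\<in>V. 4)" unfolding card_arcs[OF G] by (rule sum_mono)
        then show ?thesis using K5 by simp
      next
        case (split A B u w)
        \<comment> \<open>The bounds add up without slack: 6 * (n + 2) - 20 - 2 = 6 * n - 10, where
          n is \<open>card V\<close>.\<close>
        note c = edge_split_card[OF G split] and a = card_arcs_split[OF G split]
        have IH: "card (arcs (induced E X)) + 10 \<le> 6 * card X"
          if "X \<subseteq> V" "card X < card V" "3 \<le> card X" for X
        proof -
          show ?thesis using that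
            by (intro less.hyps simple_graph_induced[OF G] K33_minor_free_subgraph[OF free]) auto
        qed
        have "A \<subseteq> V" "B \<subseteq> V" using split unfolding edge_split_def by auto
        from IH[OF this(1)] IH[OF this(2)] show ?thesis using c a by linarith
      qed
    qed
  qed
qed

section \<open>The clique bound\<close>

lemma finite_cliques: "finite V \<Longrightarrow> finite {S. is_clique V E S}"
  by (rule finite_subset[of _ "Pow V"]) (auto simp: is_clique_def)

lemma num_cliques_le_power:
  assumes "finite V"
  shows "num_cliques V E \<le> 2 ^ card V"
proof -
  have "num_cliques V E \<le> card (Pow V)"
    unfolding num_cliques_def using assms by (intro card_mono) (auto simp: is_clique_def)
  then show ?thesis using assms by (simp add: card_Pow)
qed

text \<open>Each set of common neighbours accounts for at most two lost cliques, one with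
  \<open>w\<close> added and one with both \<open>v\<close> and \<open>w\<close> added; hence the
  factor 2.\<close>

lemma num_cliques_contract:
  assumes G: "simple_graph V E" and vw: "E v w"
  shows "num_cliques V E \<le>
    num_cliques (V - {w}) (contract E v w) + 2 * 2 ^ card (common_nbrs E v w)"
proof -
  have sym: "E x y \<Longrightarrow> E y x" and irr: "\<not> E x x" and inV: "E x y \<Longrightarrow> x \<in> V \<and> y \<in> V" for x y
    using G unfolding simple_graph_def by blast+
  have finV: "finite V" using G unfolding simple_graph_def by blast
  define P where "P = Pow (common_nbrs E v w)"
  have finC: "finite (common_nbrs E v w)"
    using inV by (intro finite_subset[OF _ finV]) (auto simp: common_nbrs_def)
  then have P: "finite P" "card P = 2 ^ card (common_nbrs E v w)"
    by (auto simp: P_def card_Pow)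
  \<comment> \<open>\<open>P\<close> absorbs the cliques that vanish (those containing v and w) or become duplicates
    (those containing w that stay cliques when w is replaced by v). Replacing w by v maps the
    remaining cliques containing w, collected in \<open>L\<close>, to sets that were not cliques before.\<close>
  define K where "K = {S. is_clique V E S \<and> w \<notin> S}"
  define L where "L = {S. is_clique V E S \<and> w \<in> S \<and> v \<notin> S \<and> \<not> S - {w} \<subseteq> {u. E v u}}"
  define h where "h S = insert v (S - {w})" for S
  have finK: "finite K" and finL: "finite L"
    by (rule finite_subset[OF _ finite_cliques[OF finV, of E]]; auto simp: K_def L_def)+
  have "S \<in> K \<union> L \<union> (insert w ` P \<union> (insert v \<circ> insert w) ` P)" if S: "is_clique V E S" for S
  proof -
    consider "w \<notin> S" | "w \<in> S" "v \<in> S" | "w \<in> S" "v \<notin> S" "S - {w} \<subseteq> {u. E v u}" | "S \<in> L"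
      using S by (auto simp: L_def)
    then show ?thesis
    proof cases
      case 1
      then show ?thesis using S by (simp add: K_def)
    next
      case 2
      then have "S - {v, w} \<in> P" using S by (auto simp: P_def common_nbrs_def is_clique_def)
      moreover have "S = (insert v \<circ> insert w) (S - {v, w})" using 2 by auto
      ultimately show ?thesis by blast
    next
      case 3
      then have "S - {w} \<in> P" using S by (auto simp: P_def common_nbrs_def is_clique_def)
      moreover have "S = insert w (S - {w})" using 3 by auto
      ultimately show ?thesis by blast
    qed simp
  qed
  then have "num_cliques V E \<le> card (K \<union> L \<union> (insert w ` P \<union> (insert v \<circ> insert w) ` P))"
    unfolding num_cliques_def using finK finL P(1) by (intro card_mono) auto
  also have "\<dots> \<le> card (K \<union> L) + (card (insert w ` P) + card ((insert v \<circ> insert w) ` P))"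
    by (meson card_Un_le add_left_mono order_trans)
  also have "\<dots> \<le> card K + card L + 2 * 2 ^ card (common_nbrs E v w)"
    using card_Un_le[of K L] card_image_le[OF P(1), of "insert w"]
      card_image_le[OF P(1), of "insert v \<circ> insert w"] P(2) by linarith
  also have "card K + card L = card (K \<union> h ` L)"
  proof -
    have "inj_on h L"
    proof (rule inj_onI)
      fix S T assume "S \<in> L" "T \<in> L" "h S = h T"
      then have "v \<notin> S" "v \<notin> T" "w \<in> S" "w \<in> T" and
        "insert v (S - {w}) = insert v (T - {w})" by (auto simp: L_def h_def)
      then show "S = T" by (metis Diff_iff insert_Diff insert_ident)
    qed
    moreover have "K \<inter> h ` L = {}"
      by (auto simp: K_def L_def h_def is_clique_def)
    ultimately show ?thesis using finK finL by (simp add: card_Un_disjoint card_image)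
  qed
  also have "\<dots> \<le> num_cliques (V - {w}) (contract E v w)"
    unfolding num_cliques_def
  proof (intro card_mono finite_cliques subsetI CollectI)
    show "finite (V - {w})" using finV by simp
    fix S assume "S \<in> K \<union> h ` L"
    then consider "S \<in> K" | T where "T \<in> L" "S = h T" by blast
    then show "is_clique (V - {w}) (contract E v w) S"
    proof cases
      case 1
      then show ?thesis by (auto simp: K_def is_clique_def contract_def)
    next
      case 2
      have "v \<noteq> w" using vw irr by auto
      have T: "T \<subseteq> V" "w \<in> T" "v \<notin> T" "\<And>x y. x \<in> T \<Longrightarrow> y \<in> T \<Longrightarrow> x \<noteq> y \<Longrightarrow> E x y"
        using 2(1) by (auto simp: L_def is_clique_def)
      show ?thesis unfolding is_clique_def 2(2) h_def contract_def
      proof (intro conjI ballI impI)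
        show "insert v (T - {w}) \<subseteq> V - {w}" using T(1) inV[OF vw] \<open>v \<noteq> w\<close> by auto
        fix x y assume xy: "x \<in> insert v (T - {w})" "y \<in> insert v (T - {w})" "x \<noteq> y"
        then show "x \<noteq> y" "x \<noteq> w" "y \<noteq> w" using \<open>v \<noteq> w\<close> by auto
        show "E x y \<or> x = v \<and> E w y \<or> y = v \<and> E x w"
          using xy T(2,4) by blast
      qed
    qed
  qed
  finally show ?thesis by simp
qed

lemma num_cliques_isolated:
  assumes G: "simple_graph V E" and v: "v \<in> V" "{u. E v u} = {}"
  shows "num_cliques V E \<le> num_cliques (V - {v}) (induced E (V - {v})) + 1"
proof -
  have finV: "finite V" using G unfolding simple_graph_def by blast
  have "{S. is_clique V E S} \<subseteq> insert {v} {S. is_clique (V - {v}) (induced E (V - {v})) S}"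
    using v(2) by (auto simp: is_clique_def)
  then have "num_cliques V E \<le> card (insert {v} {S. is_clique (V - {v}) (induced E (V - {v})) S})"
    unfolding num_cliques_def using finite_cliques[of "V - {v}"] finV by (intro card_mono) auto
  also have "\<dots> \<le> num_cliques (V - {v}) (induced E (V - {v})) + 1"
    unfolding num_cliques_def using finite_cliques[of "V - {v}"] finV by (simp add: card_insert_if)
  finally show ?thesis .
qed

text \<open>No edge joins \<open>A - B\<close> to \<open>B - A\<close>, so each clique lies in one
  side. The cliques in both sides are the four subsets of the edge \<open>{u, w}\<close>.\<close>

lemma num_cliques_split:
  assumes G: "simple_graph V E" and s: "edge_split V E A B u w"
  shows "num_cliques V E + 4 = num_cliques A (induced E A) + num_cliques B (induced E B)"
proof -
  have V: "A \<union> B = V" and I: "A \<inter> B = {u, w}" and uw: "E u w"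
    and adj: "\<And>x y. E x y \<Longrightarrow> x \<in> A \<and> y \<in> A \<or> x \<in> B \<and> y \<in> B"
    using s unfolding edge_split_def by blast+
  have sym: "E w u" and ne: "u \<noteq> w" and finV: "finite V"
    using G uw unfolding simple_graph_def by blast+
  let ?K = "\<lambda>X. {S. is_clique X (induced E X) S}"
  have "S \<in> ?K A \<union> ?K B" if S: "is_clique V E S" for S
  proof -
    have "S \<subseteq> A \<or> S \<subseteq> B"
    proof (rule ccontr)
      assume "\<not> (S \<subseteq> A \<or> S \<subseteq> B)"
      then obtain x y where "x \<in> S" "x \<notin> A" "y \<in> S" "y \<notin> B" by blast
      moreover from this have "x \<noteq> y" using S V by (auto simp: is_clique_def)
      ultimately show False using S adj[of x y] by (auto simp: is_clique_def)
    qed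
    then show ?thesis using S by (auto simp: is_clique_def)
  qed
  moreover have "S \<in> ?K A \<union> ?K B \<Longrightarrow> is_clique V E S" for S
    using V by (auto simp: is_clique_def)
  ultimately have un: "{S. is_clique V E S} = ?K A \<union> ?K B" by blast
  have int: "?K A \<inter> ?K B = Pow {u, w}"
  proof (intro equalityI subsetI)
    fix S assume "S \<in> ?K A \<inter> ?K B"
    then show "S \<in> Pow {u, w}" using I by (auto simp: is_clique_def)
  next
    fix S assume "S \<in> Pow {u, w}"
    moreover have "u \<in> A" "u \<in> B" "w \<in> A" "w \<in> B" using I by blast+
    ultimately show "S \<in> ?K A \<inter> ?K B" using uw sym unfolding is_clique_def by blast
  qed
  have "finite (?K A)" "finite (?K B)" using finV V by (auto intro!: finite_cliques)
  from card_Un_Int[OF this] show ?thesis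
    unfolding num_cliques_def un int using ne by (simp add: card_Pow)
qed

text \<open>The bound is multiplied by 3 to stay in the natural numbers; a vertex then has an
  allowance of 28.\<close>

lemma num_cliques_le:
  assumes "simple_graph V E" "K33_minor_free V E" "3 \<le> card V"
  shows "3 * num_cliques V E + 44 \<le> 28 * card V"
  using assms
proof (induction "card V" arbitrary: V E rule: less_induct)
  case less
  note G = less.prems(1) and free = less.prems(2)
  have inV: "E x y \<Longrightarrow> x \<in> V \<and> y \<in> V" for x y
    using G unfolding simple_graph_def by blast
  have finV: "finite V" using G unfolding simple_graph_def by blast
  have "card (arcs E) + 10 \<le> 6 * card V"
    using card_arcs_le[OF G free] less.prems(3) by simp
  then have "(\<Sum>v\<in>V. card {u. E v u}) < (\<Sum>v\<in>V. 6)"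
    using card_arcs[OF G] by simp
  then obtain v where "v \<in> V" "card {u. E v u} < 6"
    by (meson not_less sum_mono)
  then have v: "v \<in> V" "card {u. E v u} \<le> 5" by simp_all
  show ?case
  proof (cases "card V = 3")
    case True
    \<comment> \<open>At most 8 cliques: 24 + 44 = 68, below 84.\<close>
    then show ?thesis using num_cliques_le_power[OF finV, of E] by simp
  next
    case False
    then have n4: "4 \<le> card V" using less.prems(3) by simp
    have IH: "3 * num_cliques X (induced E X) + 44 \<le> 28 * card X"
      if "X \<subseteq> V" "card X < card V" "3 \<le> card X" for X
      using that
      by (intro less.hyps simple_graph_induced[OF G] K33_minor_free_subgraph[OF free]) auto
    from G free v show ?thesis
    proof (cases rule: small_degree_cases)
      case isolated
      have c: "card (V - {v}) = card V - 1" using v(1) finV by simp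
      have "3 * num_cliques (V - {v}) (induced E (V - {v})) + 44 \<le> 28 * card (V - {v})"
        using c n4 by (intro IH) auto
      then show ?thesis
        using num_cliques_isolated[OF G v(1) isolated] c n4 by linarith
    next
      case (contract x y)
      have y: "card (V - {y}) = card V - 1" using inV[OF contract(1)] finV by simp
      have "3 * num_cliques (V - {y}) (contract E x y) + 44 \<le> 28 * card (V - {y})"
        using y n4 by (intro less.hyps simple_graph_contract[OF G]
            K33_minor_free_contract[OF G _ free] contract(1)) auto
      \<comment> \<open>The loss is at most 2 * 4 = 8 cliques, and 3 * 8 = 24 is within the
        allowance of 28.\<close>
      moreover have "(2::nat) ^ card (common_nbrs E x y) \<le> 2 ^ 2"
        using contract(2) by (intro power_increasing) auto
      ultimately show ?thesis using num_cliques_contract[OF G contract(1)] y n4 by simp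
    next
      case K5
      \<comment> \<open>At most 32 cliques: 96 + 44 = 140 = 28 * 5, with equality for the complete
        graph.\<close>
      then show ?thesis using num_cliques_le_power[OF finV, of E] by simp
    next
      case (split A B u w)
      \<comment> \<open>Again there is no slack: 28 * (n + 2) - 88 - 12 = 28 * n - 44, where n is
        \<open>card V\<close>.\<close>
      have "A \<subseteq> V" "B \<subseteq> V" using split unfolding edge_split_def by auto
      from IH[OF this(1)] IH[OF this(2)] show ?thesis
        using edge_split_card[OF G split] num_cliques_split[OF G split] by linarith
    qed
  qed
qed

section \<open>Copies of $K_5$ glued along an edge\<close>

text \<open>The common edge is 01, and the remaining vertices are grouped into
  triples {3b - 1, 3b, 3b + 1} for b \<ge> 1.\<close>
definition book :: "nat \<Rightarrow> nat \<Rightarrow> nat \<Rightarrow> bool" where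
  "book n x y \<longleftrightarrow> x < n \<and> y < n \<and> x \<noteq> y \<and> (x < 2 \<or> y < 2 \<or> (x + 1) div 3 = (y + 1) div 3)"

lemma simple_graph_book: "simple_graph {..<n} (book n)"
  unfolding simple_graph_def book_def by auto

lemma triple_eq: "{x::nat. 2 \<le> x \<and> (x + 1) div 3 = Suc b} = {3 * b + 2, 3 * b + 3, 3 * b + 4}"
  by auto

lemma K33_minor_free_book: "K33_minor_free {..<n} (book n)"
  unfolding K33_minor_free_def
proof
  assume "is_minor K33_V K33_E {..<n} (book n)"
  then obtain f where
    con: "\<forall>i\<in>K33_V. f i \<subseteq> {..<n} \<and> connected_set (book n) (f i)" and
    dis: "\<forall>i\<in>K33_V. \<forall>j\<in>K33_V. i \<noteq> j \<longrightarrow> f i \<inter> f j = {}" and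
    adj: "\<forall>i\<in>K33_V. \<forall>j\<in>K33_V. K33_E i j \<longrightarrow> (\<exists>x\<in>f i. \<exists>y\<in>f j. book n x y)"
    unfolding is_minor_def by (elim exE conjE) (rule that)
  \<comment> \<open>Without the vertices 0 and 1, edges stay within a page. The branch sets indexed
    by \<open>T\<close> avoid both vertices, so each lies in one page.\<close>
  define page where "page x = (x + 1) div 3" for x :: nat
  define T where "T = {i \<in> K33_V. 0 \<notin> f i \<and> 1 \<notin> f i}"
  have ge2: "2 \<le> x" if "i \<in> T" "x \<in> f i" for i x
    using that by (cases "x = 0 \<or> x = 1") (auto simp: T_def)
  have page: "page x = page y" if i: "i \<in> T" and x: "x \<in> f i" and y: "y \<in> f i" for i x y
  proof -
    have "(induced (book n) (f i))\<^sup>*\<^sup>* x y"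
      using con i x y unfolding T_def connected_set_def by blast
    then show ?thesis
    proof induction
      case (step y z)
      then show ?case using ge2[OF i, of y] ge2[OF i, of z] by (auto simp: book_def page_def)
    qed simp
  qed
  have page_adj: "page x = page y"
    if ij: "i \<in> T" "j \<in> T" "K33_E i j" and xy: "x \<in> f i" "y \<in> f j" for i j x y
  proof -
    obtain x' y' where "x' \<in> f i" "y' \<in> f j" "book n x' y'"
      using adj ij unfolding T_def by blast
    moreover from this have "page x' = page y'"
      using ge2[OF ij(1), of x'] ge2[OF ij(2), of y'] by (auto simp: book_def page_def)
    ultimately show ?thesis using page ij xy by metis
  qed
  have K: "finite K33_V" "card K33_V = 6" by (auto simp: K33_V_def)
  have meets: "card {i \<in> K33_V. z \<in> f i} \<le> 1" for z
    using K(1) dis by (subst One_nat_def, subst card_le_Suc0_iff_eq) auto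
  have "K33_V \<subseteq> T \<union> ({i \<in> K33_V. 0 \<in> f i} \<union> {i \<in> K33_V. 1 \<in> f i})" by (auto simp: T_def)
  then have "6 \<le> card (T \<union> ({i \<in> K33_V. 0 \<in> f i} \<union> {i \<in> K33_V. 1 \<in> f i}))"
    using K by (subst K(2)[symmetric], intro card_mono) (auto simp: T_def)
  also have "\<dots> \<le> card T + (card {i \<in> K33_V. 0 \<in> f i} + card {i \<in> K33_V. 1 \<in> f i})"
    by (meson card_Un_le add_left_mono order_trans)
  finally have T4: "4 \<le> card T" using meets[of 0] meets[of 1] by linarith
  have finT: "finite T" using K by (simp add: T_def)
  \<comment> \<open>Each side of the bipartition has only three indices, so \<open>T\<close> meets
    both. Every index in \<open>T\<close> is then adjacent to \<open>i\<close> or \<open>j\<close>,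
    and all these branch sets lie in the page of \<open>p\<close>.\<close>
  have "\<not> T \<subseteq> {3, 4, 5}" "\<not> T \<subseteq> {0, 1, 2}"
    using T4 card_mono[of "{3, 4, 5::nat}" T] card_mono[of "{0, 1, 2::nat}" T] by auto
  then obtain i j where ij: "i \<in> T" "i \<notin> {3, 4, 5}" "j \<in> T" "j \<notin> {0, 1, 2}" by blast
  then have ij': "i < 3" "3 \<le> j" "j < 6" by (auto simp: T_def K33_V_def)
  have ne: "f k \<noteq> {}" if "k \<in> T" for k
    using con that by (auto simp: T_def connected_set_def)
  obtain p q where pq: "p \<in> f i" "q \<in> f j" using ne ij by blast
  have "page p = page q" using page_adj[OF ij(1,3) _ pq] ij' by (simp add: K33_E_def)
  have pages: "page x = page p" if "k \<in> T" "x \<in> f k" for k x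
  proof (cases "k < 3")
    case True
    then have "K33_E k j" using ij' by (simp add: K33_E_def)
    then show ?thesis using page_adj[OF that(1) ij(3) _ that(2) pq(2)] \<open>page p = page q\<close> by simp
  next
    case False
    then have "K33_E k i" using ij' that(1) by (auto simp: K33_E_def T_def K33_V_def)
    then show ?thesis using page_adj[OF that(1) ij(1) _ that(2) pq(1)] by simp
  qed
  \<comment> \<open>Page 0 contains only the vertices 0 and 1, so the page of \<open>p\<close> is a
    triple, too small for four disjoint nonempty sets.\<close>
  obtain b where b: "page p = Suc b"
    using ge2[OF ij(1) pq(1)] by (cases "page p") (auto simp: page_def)
  have "(\<Union>k\<in>T. f k) \<subseteq> {3 * b + 2, 3 * b + 3, 3 * b + 4}"
    unfolding triple_eq[symmetric] using ge2 pages b by (auto simp: page_def)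
  then have "card (\<Union>k\<in>T. f k) \<le> card {3 * b + 2, 3 * b + 3, 3 * b + 4}"
    by (intro card_mono) auto
  also have "\<dots> = 3" by simp
  finally have "card (\<Union>k\<in>T. f k) \<le> 3" .
  moreover have fin: "finite (f k)" if "k \<in> T" for k
    using that con finite_subset[of "f k" "{..<n}"] by (auto simp: T_def)
  have "card (\<Union>k\<in>T. f k) = (\<Sum>k\<in>T. card (f k))"
    using finT fin dis by (intro card_UN_disjoint) (auto simp: T_def)
  moreover have "(\<Sum>k\<in>T. 1) \<le> (\<Sum>k\<in>T. card (f k))"
    using ne fin by (intro sum_mono) (simp add: Suc_le_eq card_gt_0_iff)
  ultimately show False using T4 by simp
qed

text \<open>Each triple glues on another copy of $K_5$ along the edge 01, which adds 32 - 4 = 28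
  cliques; the edge alone has 4.\<close>

lemma num_cliques_book: "num_cliques {..<3 * k + 2} (book (3 * k + 2)) = 28 * k + 4"
proof (induction k)
  case 0
  have "{S. is_clique {..<3 * 0 + 2} (book (3 * 0 + 2)) S} = Pow {..<2}"
    by (auto simp: is_clique_def book_def)
  then show ?case by (simp add: num_cliques_def card_Pow)
next
  case (Suc k)
  let ?n = "3 * k + 2" and ?n' = "3 * Suc k + 2"
  let ?B = "{0, 1, 3 * k + 2, 3 * k + 3, 3 * k + 4}"
  let ?A = "{..<?n}"
  show ?case
  \<comment> \<open>For the first triple \<open>?B\<close> is the whole vertex set, so there is no
    proper split and the cliques are counted directly.\<close>
  proof (cases "k = 0")
    case True
    have "book 5 x y" if "x < 5" "y < 5" "x \<noteq> y" for x y
    proof -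
      have "(z + 1) div 3 = 1" if "\<not> z < 2" "z < 5" for z :: nat
        using that by (auto simp: div_nat_eqI)
      then show ?thesis using that by (auto simp: book_def)
    qed
    then have "{S. is_clique {..<?n'} (book ?n') S} = Pow {..<5}"
      using True unfolding is_clique_def by auto
    then show ?thesis using True by (simp add: num_cliques_def card_Pow)
  next
    case False
    have split: "edge_split {..<?n'} (book ?n') ?A ?B 0 1"
      unfolding edge_split_def
    proof (intro conjI allI impI)
      fix x y assume xy: "book ?n' x y"
      have top: "z = 3 * k + 2 \<or> z = 3 * k + 3 \<or> z = 3 * k + 4" if "\<not> z < ?n" "z < ?n'" for z
        using that by auto
      \<comment> \<open>Old vertices have page at most \<open>k\<close> and the new ones page
        \<open>k + 1\<close>, so an edge between them must use 0 or 1.\<close>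
      have low: "(z + 1) div 3 \<le> k" if "z < ?n" for z
        using that by linarith
      have high: "(z + 1) div 3 = Suc k" if "\<not> z < ?n" "z < ?n'" for z
        using that by (auto simp: div_nat_eqI)
      consider "x < ?n" "y < ?n" | "\<not> x < ?n" "\<not> y < ?n" | "\<not> x < ?n" "y < ?n" | "x < ?n" "\<not> y < ?n"
        by blast
      then show "x \<in> ?A \<and> y \<in> ?A \<or> x \<in> ?B \<and> y \<in> ?B"
      proof cases
        case 1
        then show ?thesis by simp
      next
        case 2
        then show ?thesis using xy top[of x] top[of y] by (auto simp: book_def)
      next
        case 3
        then have "y < 2" using xy high[of x] low[of y] by (auto simp: book_def)
        then show ?thesis using 3 xy top[of x] by (auto simp: book_def)
      next
        case 4
        then have "x < 2" using xy high[of y] low[of x] by (auto simp: book_def)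
        then show ?thesis using 4 xy top[of y] by (auto simp: book_def)
      qed
    next
      have V: "{..<?n'} = ?A \<union> {3 * k + 2, 3 * k + 3, 3 * k + 4}" by auto
      show "?A \<union> ?B = {..<?n'}" unfolding V by auto
      show "?A \<inter> ?B = {0, 1}" by auto
      show "?A \<subset> {..<?n'}" by (simp only: lessThan_strict_subset_iff) simp
      \<comment> \<open>As \<open>k\<close> is positive, the vertex 2 belongs to an earlier
        triple.\<close>
      have "2 \<in> {..<?n'} - ?B" using False by auto
      moreover have "?B \<subseteq> {..<?n'}" by auto
      ultimately show "?B \<subset> {..<?n'}" by blast
      show "book ?n' 0 1" by (simp add: book_def)
    qed
    have A: "induced (book ?n') ?A = book ?n" by (intro ext) (auto simp: book_def)
    have edge: "book ?n' x y" if "x \<in> ?B" "y \<in> ?B" "x \<noteq> y" for x y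
      using that by (auto simp: book_def)
    have "{S. is_clique ?B (induced (book ?n') ?B) S} = Pow ?B"
      using edge unfolding is_clique_def by blast
    then have "num_cliques ?B (induced (book ?n') ?B) = card (Pow ?B)"
      unfolding num_cliques_def by (rule arg_cong)
    also have "\<dots> = 32" by (simp add: card_Pow)
    finally have B: "num_cliques ?B (induced (book ?n') ?B) = 32" .
    have "num_cliques {..<?n'} (book ?n') + 4 = 28 * k + 4 + 32"
      using num_cliques_split[OF simple_graph_book split] unfolding A B Suc .
    then show ?thesis by simp
  qed
qed

theorem theorem7:
  shows "(\<forall>(V :: 'a set) E. simple_graph V E \<and> card V \<ge> 3 \<and> K33_minor_free V E \<longrightarrow>
            real (num_cliques V E) \<le> 4 / 3 * (7 * real (card V) - 11))
       \<and> (\<forall>n::nat. n \<ge> 5 \<and> n mod 3 = 2 \<longrightarrow>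
            (\<exists>(V :: nat set) E. simple_graph V E \<and> card V = n \<and> K33_minor_free V E \<and>
               real (num_cliques V E) = 4 / 3 * (7 * real n - 11)))"
proof (intro conjI allI impI)
  fix V :: "'a set" and E
  assume "simple_graph V E \<and> card V \<ge> 3 \<and> K33_minor_free V E"
  then have "3 * num_cliques V E + 44 \<le> 28 * card V" using num_cliques_le by blast
  then have "real (3 * num_cliques V E + 44) \<le> real (28 * card V)" by (rule of_nat_mono)
  then show "real (num_cliques V E) \<le> 4 / 3 * (7 * real (card V) - 11)" by simp
next
  fix n :: nat
  assume "n \<ge> 5 \<and> n mod 3 = 2"
  then have n: "n = 3 * (n div 3) + 2" by presburger
  have "simple_graph {..<n} (book n)" by (rule simple_graph_book)
  moreover have "K33_minor_free {..<n} (book n)" by (rule K33_minor_free_book)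
  \<comment> \<open>With n = 3k + 2, the value (4/3)(7n - 11) equals (4/3)(21k + 3) = 28k +
    4.\<close>
  moreover have "num_cliques {..<n} (book n) = 28 * (n div 3) + 4"
    using num_cliques_book[of "n div 3"] n by simp
  moreover have "real n = 3 * real (n div 3) + 2" by (subst n) simp
  ultimately show "\<exists>(V :: nat set) E. simple_graph V E \<and> card V = n \<and> K33_minor_free V E \<and>
               real (num_cliques V E) = 4 / 3 * (7 * real n - 11)"
    by (intro exI[of _ "{..<n}"] exI[of _ "book n"]) simp
qed

end
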